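(* Let $q\ge 2$ be an integer, let $\omega$ be an end of the $(q+1)$-homogeneous tree $T_{q+1}$, let $h_\omega$ be a horofunction on $T_{q+1}$ tending to $-\infty$ along the rays representing $\omega$, and let $\alpha\in\mathbb{R}$. Then the positive eigenfunction $v\mapsto q^{-\alpha h_\omega(v)}$ of the Laplace operator on $T_{q+1}$, which has eigenvalue $s_\alpha=\frac{q^{\alpha}+q^{1-\alpha}}{q+1}$, is minimal if and only if $\alpha\in[1/2,+\infty)$.
   Context: $T_{q+1}$ is the infinite tree in which every vertex has valency $q+1$, with graph metric $d$. The Laplace operator acts on functions on the vertex set by averaging over neighbors: $(\Delta f)(v)=\frac{1}{q+1}\sum_{w\sim v} f(w)$ (so harmonic functions are those invariant under $\Delta$). An eigenfunction with eigenvalue $s$ is a function $f$ with $\Delta f=sf$. A horofunction on $T_{q+1}$ is a function that is unbounded from below and is the pointwise limit of functions of the form $x\mapsto d(x,x_0)+C$ with $x_0$ a vertex and $C\in\mathbb{R}$. For each end $\omega$ the horofunction tending to $-\infty$ along the rays representing $\omega$ is unique up to an additive constant; it decreases by $1$ when moving from a vertex to its neighbor in the direction of $\omega$ and increases by $1$ when moving to any of the other $q$ neighbors. A positive eigenfunction $f$ with eigenvalue $s$ is minimal if every nonnegative eigenfunction $g$ with the same eigenvalue $s$ satisfying $g\le f$ is a constant multiple of $f$. *)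

theory Defs
  imports Complex_Main
begin

text \<open>A simple graph is given by a symmetric irreflexive adjacency relation \<open>E\<close> on a
  vertex type \<open>'v\<close>; every element of the type is a vertex.\<close>

definition graph_cycle :: "('v \<Rightarrow> 'v \<Rightarrow> bool) \<Rightarrow> 'v list \<Rightarrow> bool" where
  "graph_cycle E xs \<longleftrightarrow>
     length xs \<ge> 3 \<and> distinct xs \<and> successively E xs \<and> E (last xs) (hd xs)"

definition is_tree :: "('v \<Rightarrow> 'v \<Rightarrow> bool) \<Rightarrow> bool" where
  "is_tree E \<longleftrightarrow> symp E \<and> irreflp E \<and> (\<forall>x y. E\<^sup>*\<^sup>* x y) \<and> (\<nexists>xs. graph_cycle E xs)"

text \<open>The tree of valency \<open>q + 1\<close> is described up to isomorphism.\<close>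

definition homogeneous_tree :: "nat \<Rightarrow> ('v \<Rightarrow> 'v \<Rightarrow> bool) \<Rightarrow> bool" where
  "homogeneous_tree q E \<longleftrightarrow>
     is_tree E \<and> infinite (UNIV :: 'v set) \<and> (\<forall>v. finite {w. E v w} \<and> card {w. E v w} = q + 1)"

text \<open>\<open>(E ^^ n) x y\<close> says that there is a walk of length \<open>n\<close> from \<open>x\<close> to \<open>y\<close>, so this is
  the graph metric when \<open>E\<close> is connected.\<close>

definition graph_dist :: "('v \<Rightarrow> 'v \<Rightarrow> bool) \<Rightarrow> 'v \<Rightarrow> 'v \<Rightarrow> nat" where
  "graph_dist E x y = (LEAST n. (E ^^ n) x y)"

definition rays :: "('v \<Rightarrow> 'v \<Rightarrow> bool) \<Rightarrow> (nat \<Rightarrow> 'v) set" where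
  "rays E = {r. (\<forall>n. E (r n) (r (Suc n))) \<and> inj r}"

text \<open>In a tree, two rays represent the same end iff they agree after deleting finite initial
  segments.\<close>

definition ray_equiv :: "('v \<Rightarrow> 'v \<Rightarrow> bool) \<Rightarrow> ((nat \<Rightarrow> 'v) \<times> (nat \<Rightarrow> 'v)) set" where
  "ray_equiv E = {(r, r'). r \<in> rays E \<and> r' \<in> rays E \<and> (\<exists>m n. \<forall>k. r (m + k) = r' (n + k))}"

definition tree_ends :: "('v \<Rightarrow> 'v \<Rightarrow> bool) \<Rightarrow> (nat \<Rightarrow> 'v) set set" where
  "tree_ends E = rays E // ray_equiv E"

lemma equiv_ray_equiv: "equiv (rays E) (ray_equiv E)"
proof (rule equivI)
  show "ray_equiv E \<subseteq> rays E \<times> rays E"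
    by (auto simp: ray_equiv_def)
  show "refl_on (rays E) (ray_equiv E)"
    by (auto simp: refl_on_def ray_equiv_def)
  show "sym (ray_equiv E)"
    unfolding sym_def ray_equiv_def by (auto, metis)
  show "trans (ray_equiv E)"
  proof (rule transI)
    fix r s t
    assume "(r, s) \<in> ray_equiv E" "(s, t) \<in> ray_equiv E"
    then obtain m n m' n' where *: "r \<in> rays E" "t \<in> rays E"
      "\<And>k. r (m + k) = s (n + k)" "\<And>k. s (m' + k) = t (n' + k)"
      by (auto simp: ray_equiv_def)
    have "r ((m + m') + k) = t ((n' + n) + k)" for k
      using *(3)[of "m' + k"] *(4)[of "n + k"] by (simp add: ac_simps)
    with *(1,2) show "(r, t) \<in> ray_equiv E"
      unfolding ray_equiv_def by blast
  qed
qed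

definition horofunction :: "('v \<Rightarrow> 'v \<Rightarrow> bool) \<Rightarrow> ('v \<Rightarrow> real) \<Rightarrow> bool" where
  "horofunction E h \<longleftrightarrow>
     \<not> bdd_below (range h) \<and>
     (\<exists>(x :: nat \<Rightarrow> 'v) (C :: nat \<Rightarrow> real).
        \<forall>v. (\<lambda>n. real (graph_dist E v (x n)) + C n) \<longlonglongrightarrow> h v)"

definition tends_to_end :: "('v \<Rightarrow> real) \<Rightarrow> (nat \<Rightarrow> 'v) set \<Rightarrow> bool" where
  "tends_to_end h \<omega> \<longleftrightarrow> (\<forall>r\<in>\<omega>. filterlim (\<lambda>n. h (r n)) at_bot sequentially)"

definition laplace :: "nat \<Rightarrow> ('v \<Rightarrow> 'v \<Rightarrow> bool) \<Rightarrow> ('v \<Rightarrow> real) \<Rightarrow> 'v \<Rightarrow> real" where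
  "laplace q E f v = (1 / (real q + 1)) * (\<Sum>w | E v w. f w)"

definition eigenfunction :: "nat \<Rightarrow> ('v \<Rightarrow> 'v \<Rightarrow> bool) \<Rightarrow> real \<Rightarrow> ('v \<Rightarrow> real) \<Rightarrow> bool" where
  "eigenfunction q E s f \<longleftrightarrow> (\<forall>v. laplace q E f v = s * f v)"

definition positive_eigenfunction ::
    "nat \<Rightarrow> ('v \<Rightarrow> 'v \<Rightarrow> bool) \<Rightarrow> real \<Rightarrow> ('v \<Rightarrow> real) \<Rightarrow> bool" where
  "positive_eigenfunction q E s f \<longleftrightarrow> eigenfunction q E s f \<and> (\<forall>v. f v > 0)"

definition minimal_eigenfunction ::
    "nat \<Rightarrow> ('v \<Rightarrow> 'v \<Rightarrow> bool) \<Rightarrow> real \<Rightarrow> ('v \<Rightarrow> real) \<Rightarrow> bool" where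
  "minimal_eigenfunction q E s f \<longleftrightarrow>
     positive_eigenfunction q E s f \<and>
     (\<forall>g. eigenfunction q E s g \<and> (\<forall>v. 0 \<le> g v) \<and> (\<forall>v. g v \<le> f v)
        \<longrightarrow> (\<exists>c. \<forall>v. g v = c * f v))"

end

theory Submission
  imports Defs
begin

text \<open>
  A horofunction singles out at every vertex \<open>v\<close> one neighbour \<open>p v\<close>, its parent, with
  \<open>h (p v) = h v - 1\<close>, while \<open>h\<close> is \<open>h v + 1\<close> at the \<open>q\<close> other neighbours, the children of \<open>v\<close>.

  Let \<open>\<alpha> \<ge> 1/2\<close> and let \<open>g \<le> f\<close> be a nonnegative eigenfunction. The quotient \<open>g / f\<close> is harmonic for
  a walk that steps to the parent with probability at least \<open>1/2\<close>. If it changes by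
  \<open>d\<close> from \<open>p v\<close> to \<open>v\<close>, then some child of \<open>v\<close> continues this change by at least as much, and
  iterating this contradicts the boundedness of \<open>g / f\<close>. So the quotient is constant along edges.

  For \<open>\<alpha> < 1/2\<close>, the functions with exponents \<open>\<alpha>\<close> and \<open>1 - \<alpha>\<close> share the eigenvalue. A combination
  of them vanishing at \<open>u\<close>, placed with opposite signs below two children of \<open>u\<close> and
  extended by \<open>0\<close>, is an eigenfunction \<open>K\<close> with \<open>\<bar>K\<bar> \<le> f\<close>, and \<open>(f + K) / 2\<close> shows that \<open>f\<close> is
  not minimal.
\<close>

subsection \<open>Distances in trees\<close>

lemma graph_dist_le:
  assumes "(E ^^ n) x y"
  shows "graph_dist E x y \<le> n"
  unfolding graph_dist_def using assms by (rule Least_le)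

lemma relpowp_graph_dist:
  assumes "is_tree E"
  shows "(E ^^ graph_dist E x y) x y"
proof -
  have "\<exists>n. (E ^^ n) x y"
    using assms by (auto simp: is_tree_def rtranclp_power)
  then show ?thesis
    unfolding graph_dist_def by (rule LeastI_ex)
qed

lemma graph_dist_eq_0_iff:
  assumes "is_tree E"
  shows "graph_dist E x y = 0 \<longleftrightarrow> x = y"
  using relpowp_graph_dist[OF assms, of x y] graph_dist_le[of 0 E x x] by auto

lemma graph_dist_adj_le:
  assumes "is_tree E" "E v w"
  shows "graph_dist E v x \<le> Suc (graph_dist E w x)"
  using graph_dist_le[OF relpowp_Suc_I2[OF assms(2) relpowp_graph_dist[OF assms(1)]]] .

lemma adj_sym:
  assumes "is_tree E" "E v w"
  shows "E w v"
  using assms by (auto simp: is_tree_def dest: sympD)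

lemma exists_closer_neighbour:
  assumes T: "is_tree E" and d: "graph_dist E v x = Suc n"
  shows "\<exists>w. E v w \<and> graph_dist E w x = n"
proof -
  obtain w where w: "E v w" "(E ^^ n) w x"
    using relpowp_graph_dist[OF T, of v x] d by (metis relpowp_Suc_E2)
  then show ?thesis
    using graph_dist_le[OF w(2)] graph_dist_adj_le[OF T w(1), of x] d by force
qed

text \<open>Repetitions are removed at the front: if the new start already lies on the path,
  everything before it is cut off.\<close>

lemma rtranclp_imp_distinct_path:
  assumes "R\<^sup>*\<^sup>* a b"
  shows "\<exists>xs. xs \<noteq> [] \<and> hd xs = a \<and> last xs = b \<and> distinct xs \<and> successively R xs"
  using assms
proof (induction rule: converse_rtranclp_induct)
  case base
  then show ?case by (intro exI[of _ "[b]"]) simp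
next
  case (step a c)
  then obtain xs where xs: "xs \<noteq> []" "hd xs = c" "last xs = b" "distinct xs" "successively R xs"
    by blast
  show ?case
  proof (cases "a \<in> set xs")
    case True
    then obtain ys zs where "xs = ys @ a # zs"
      by (metis split_list)
    then show ?thesis
      using xs by (intro exI[of _ "a # zs"]) (auto simp: successively_append_iff)
  next
    case False
    then show ?thesis
      using xs step by (intro exI[of _ "a # xs"]) (auto simp: successively_Cons)
  qed
qed

text \<open>Along a geodesic from \<open>w\<close> the distance to \<open>x\<close> drops strictly,
  so every later vertex is closer to \<open>x\<close> than \<open>v\<close> is.\<close>

lemma geodesic_avoids:
  assumes T: "is_tree E" and "w \<noteq> v" "graph_dist E w x \<le> graph_dist E v x"
  shows "(\<lambda>a b. E a b \<and> a \<noteq> v \<and> b \<noteq> v)\<^sup>*\<^sup>* w x"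
  using assms(2,3)
proof (induction "graph_dist E w x" arbitrary: w)
  case 0
  then show ?case using graph_dist_eq_0_iff[OF T] by auto
next
  case (Suc n)
  obtain w' where w': "E w w'" "graph_dist E w' x = n"
    using exists_closer_neighbour[OF T] Suc by metis
  with Suc have "w' \<noteq> v" by auto
  with w' Suc show ?case
    by (intro converse_rtranclp_into_rtranclp[of _ w w']) auto
qed

text \<open>Otherwise \<open>w\<close> and \<open>w'\<close> would be joined via \<open>x\<close> by
  a path avoiding \<open>v\<close>, and \<open>v\<close> would close it to a cycle. Allowing equal
  distances also excludes neighbours level with \<open>v\<close> once a closer one exists.\<close>

lemma not_further_neighbour_unique:
  assumes T: "is_tree E" and "E v w" "E v w'"
    and "graph_dist E w x \<le> graph_dist E v x" "graph_dist E w' x \<le> graph_dist E v x"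
  shows "w = w'"
proof (rule ccontr)
  assume neq: "w \<noteq> w'"
  let ?R = "\<lambda>a b. E a b \<and> a \<noteq> v \<and> b \<noteq> v"
  have nv: "w \<noteq> v" "w' \<noteq> v"
    using assms by (auto simp: is_tree_def irreflp_def)
  have "symp ?R"
    using adj_sym[OF T] by (auto simp: symp_def)
  then have "?R\<^sup>*\<^sup>* x w'"
    using geodesic_avoids[OF T nv(2) assms(5)] by (rule sympD[OF symp_rtranclp])
  then have conn: "?R\<^sup>*\<^sup>* w w'"
    using geodesic_avoids[OF T nv(1) assms(4)] by (meson rtranclp_trans)
  obtain xs where xs: "xs \<noteq> []" "hd xs = w" "last xs = w'" "distinct xs" "successively ?R xs"
    using rtranclp_imp_distinct_path[OF conn] by (elim exE conjE)
  \<comment> \<open>Together with \<open>v\<close> this gives the three vertices that a cycle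
    requires.\<close>
  have len: "length xs \<ge> 2"
    using xs neq by (cases xs; cases "tl xs") auto
  have "v \<notin> set ys" if "successively ?R ys" "hd ys \<noteq> v" "ys \<noteq> []" for ys
    using that by (induction ys rule: induct_list012) auto
  then have "v \<notin> set xs"
    using xs nv(1) by blast
  moreover have "successively E xs"
    using xs(5) by (rule successively_mono) auto
  ultimately have "graph_cycle E (v # xs)"
    using xs len assms(2) adj_sym[OF T assms(3)] by (auto simp: graph_cycle_def successively_Cons)
  with T show False
    by (auto simp: is_tree_def)
qed

lemma graph_dist_neighbours:
  assumes T: "is_tree E" and "v \<noteq> x"
  shows "\<exists>u. E v u \<and> Suc (graph_dist E u x) = graph_dist E v x \<and>
             (\<forall>w. E v w \<and> w \<noteq> u \<longrightarrow> graph_dist E w x = Suc (graph_dist E v x))"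
proof -
  obtain n where n: "graph_dist E v x = Suc n"
    using assms graph_dist_eq_0_iff[OF T] by (metis not0_implies_Suc)
  then obtain u where u: "E v u" "graph_dist E u x = n"
    using exists_closer_neighbour[OF T] by metis
  have "graph_dist E w x = Suc (graph_dist E v x)" if w: "E v w" "w \<noteq> u" for w
  proof -
    have "\<not> graph_dist E w x \<le> graph_dist E v x"
      using not_further_neighbour_unique[OF T w(1) u(1), of x] w(2) u(2) n by auto
    then show ?thesis
      using graph_dist_adj_le[OF T adj_sym[OF T w(1)], of x] by simp
  qed
  with u n show ?thesis by auto
qed

subsection \<open>Parents with respect to a horofunction\<close>

text \<open>Near \<open>v\<close>, differences of \<open>h\<close> agree with differences of the
  distance to a single \<open>x n\<close> with \<open>n\<close> large, so the rule is inherited from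
  \<open>graph_dist_neighbours\<close>.\<close>

lemma horofunction_parent:
  assumes H: "homogeneous_tree q E" and "horofunction E h"
  shows "\<exists>u. E v u \<and> h u = h v - 1 \<and> (\<forall>w. E v w \<and> w \<noteq> u \<longrightarrow> h w = h v + 1)"
proof -
  have T: "is_tree E" and fin: "finite {w. E v w}"
    using H by (auto simp: homogeneous_tree_def)
  from assms(2) have unb: "\<not> bdd_below (range h)"
    and "\<exists>x C. \<forall>v. (\<lambda>n. real (graph_dist E v (x n)) + C n) \<longlonglongrightarrow> h v"
    unfolding horofunction_def by simp_all
  then obtain x C where "\<forall>v. (\<lambda>n. real (graph_dist E v (x n)) + C n) \<longlonglongrightarrow> h v"
    by (elim exE)
  then have lim: "(\<lambda>n. real (graph_dist E v (x n)) + C n) \<longlonglongrightarrow> h v" for v ..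
  define \<delta> where "\<delta> w n = real (graph_dist E w (x n)) - real (graph_dist E v (x n))" for w n
  have \<delta>: "\<delta> w \<longlonglongrightarrow> h w - h v" for w
    using tendsto_diff[OF lim[of w] lim[of v]] by (simp add: \<delta>_def[abs_def])
  obtain u where u: "h u < h v"
    using unb unfolding bdd_below_def by (auto simp: not_le)
  \<comment> \<open>If \<open>x n = v\<close>, then \<open>\<delta> u n\<close> is a distance, hence
    nonnegative, whereas its limit \<open>h u - h v\<close> is negative.\<close>
  have far: "\<forall>\<^sub>F n in sequentially. x n \<noteq> v"
  proof -
    have "\<forall>\<^sub>F n in sequentially. \<delta> u n < 0"
      using \<delta>[of u] u by (intro order_tendstoD(2)) auto
    then show ?thesis
      by eventually_elim (use graph_dist_eq_0_iff[OF T, of v v] in \<open>auto simp: \<delta>_def\<close>)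
  qed
  have val: "\<delta> w n \<in> {-1, 1}" if "x n \<noteq> v" "E v w" for w n
    using graph_dist_neighbours[OF T, of v "x n"] that unfolding \<delta>_def
    by (smt (verit) insert_iff of_nat_Suc)
  have val_lim: "h w - h v \<in> {-1, 1}" if "E v w" for w
  proof (rule Lim_in_closed_set[OF _ _ _ \<delta>])
    show "\<forall>\<^sub>F n in sequentially. \<delta> w n \<in> {-1, 1}"
      using far by eventually_elim (use val that in blast)
  qed auto
  \<comment> \<open>Elements of \<open>{-1, 1}\<close> less than 1 apart coincide; finiteness of the
    valency lets one \<open>n\<close> serve all neighbours.\<close>
  have "\<forall>\<^sub>F n in sequentially. \<forall>w\<in>{w. E v w}. \<bar>\<delta> w n - (h w - h v)\<bar> < 1"
    using fin
  proof (rule eventually_ball_finite)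
    show "\<forall>w\<in>{w. E v w}. \<forall>\<^sub>F n in sequentially. \<bar>\<delta> w n - (h w - h v)\<bar> < 1"
      using tendstoD[OF \<delta>, of 1] by (simp add: dist_real_def)
  qed
  then have "\<forall>\<^sub>F n in sequentially. x n \<noteq> v \<and> (\<forall>w\<in>{w. E v w}. \<bar>\<delta> w n - (h w - h v)\<bar> < 1)"
    using far by eventually_elim simp
  from eventually_happens'[OF sequentially_bot this]
  obtain n where n: "x n \<noteq> v" "\<And>w. E v w \<Longrightarrow> \<bar>\<delta> w n - (h w - h v)\<bar> < 1"
    by auto
  have eq: "h w = h v + \<delta> w n" if "E v w" for w
    using n(2)[OF that] val[OF n(1) that] val_lim[OF that] by auto
  obtain p where p: "E v p" "Suc (graph_dist E p (x n)) = graph_dist E v (x n)"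
    "\<And>w. E v w \<Longrightarrow> w \<noteq> p \<Longrightarrow> graph_dist E w (x n) = Suc (graph_dist E v (x n))"
    using graph_dist_neighbours[OF T, of v "x n"] n(1) by metis
  have "h p = h v - 1"
    using eq[OF p(1)] p(2) by (simp add: \<delta>_def)
  moreover have "h w = h v + 1" if "E v w" "w \<noteq> p" for w
    using eq[OF that(1)] p(3)[OF that] by (simp add: \<delta>_def)
  ultimately show ?thesis using p(1) by blast
qed

locale horofunction_tree =
  fixes q :: nat and E :: "'v \<Rightarrow> 'v \<Rightarrow> bool" and h :: "'v \<Rightarrow> real" and p :: "'v \<Rightarrow> 'v"
  assumes q_ge_2: "q \<ge> 2"
    and homogeneous: "homogeneous_tree q E"
    and adj_parent: "E v (p v)"
    and h_parent: "h (p v) = h v - 1"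
    and h_child: "E v w \<Longrightarrow> w \<noteq> p v \<Longrightarrow> h w = h v + 1"
begin

definition children :: "'v \<Rightarrow> 'v set" where
  "children v = {w. E v w \<and> w \<noteq> p v}"

lemma is_tree: "is_tree E"
  using homogeneous by (simp add: homogeneous_tree_def)

text \<open>The values of \<open>h\<close> orient each edge: a step that raises \<open>h\<close>
  lowers it when reversed, and only the parent is lower.\<close>

lemma mem_children_iff: "w \<in> children v \<longleftrightarrow> p w = v"
proof
  assume w: "w \<in> children v"
  then have "E v w" "h w = h v + 1"
    using h_child by (auto simp: children_def)
  then show "p w = v"
    using h_child[of w v] adj_sym[OF is_tree] by fastforce
next
  assume "p w = v"
  then show "w \<in> children v"
    using adj_sym[OF is_tree adj_parent, of w] h_parent[of w] h_parent[of v]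
    by (auto simp: children_def)
qed

lemma finite_children: "finite (children v)"
  and card_children: "card (children v) = q"
  and neighbours_eq: "{w. E v w} = insert (p v) (children v)"
proof -
  show eq: "{w. E v w} = insert (p v) (children v)"
    using adj_parent by (auto simp: children_def)
  have fin: "finite {w. E v w}" "card {w. E v w} = q + 1"
    using homogeneous by (auto simp: homogeneous_tree_def)
  then show "finite (children v)"
    using eq by simp
  moreover have "p v \<notin> children v"
    by (simp add: children_def)
  ultimately show "card (children v) = q"
    using fin(2) eq by simp
qed

lemma h_mem_children: "w \<in> children v \<Longrightarrow> h w = h v + 1"
  using h_child by (auto simp: children_def)

lemma sum_neighbours: "(\<Sum>w | E v w. f w) = f (p v) + (\<Sum>w\<in>children v. f w)"
  unfolding neighbours_eq using finite_children
  by (subst sum.insert) (auto simp: children_def)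

section \<open>The eigenvalue equation and exponentials of the horofunction\<close>

lemma eigenfunction_iff:
  "eigenfunction q E (l / (real q + 1)) f \<longleftrightarrow>
     (\<forall>v. f (p v) + (\<Sum>w\<in>children v. f w) = l * f v)"
  by (auto simp: eigenfunction_def laplace_def sum_neighbours field_simps)

definition level_power :: "real \<Rightarrow> 'v \<Rightarrow> real" where
  "level_power \<alpha> v = real q powr (- \<alpha> * h v)"

lemma level_power_pos: "level_power \<alpha> v > 0"
  using q_ge_2 by (simp add: level_power_def)

lemma level_power_parent: "level_power \<alpha> (p v) = real q powr \<alpha> * level_power \<alpha> v"
  by (simp add: level_power_def h_parent algebra_simps flip: powr_add)

lemma level_power_children:
  "w \<in> children v \<Longrightarrow> real q powr \<alpha> * level_power \<alpha> w = level_power \<alpha> v"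
  by (metis level_power_parent mem_children_iff)

lemma level_power_children':
  assumes "w \<in> children v"
  shows "real q * level_power \<alpha> w = real q powr (1 - \<alpha>) * level_power \<alpha> v"
  using q_ge_2 level_power_children[OF assms, of \<alpha>, symmetric]
  by (simp add: powr_diff)

lemma level_power_sum:
  "level_power \<alpha> (p v) + (\<Sum>w\<in>children v. level_power \<alpha> w)
     = (real q powr \<alpha> + real q powr (1 - \<alpha>)) * level_power \<alpha> v"
proof -
  have "(\<Sum>w\<in>children v. level_power \<alpha> w) = (\<Sum>w\<in>children v. real q powr (1 - \<alpha>) * level_power \<alpha> v / real q)"
    using q_ge_2 level_power_children' by (intro sum.cong) (auto simp: field_simps)
  also have "\<dots> = real q powr (1 - \<alpha>) * level_power \<alpha> v"
    using q_ge_2 by (simp add: card_children)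
  finally show ?thesis
    by (simp add: level_power_parent distrib_right)
qed

lemma positive_eigenfunction_level_power:
  "positive_eigenfunction q E ((real q powr \<alpha> + real q powr (1 - \<alpha>)) / (real q + 1)) (level_power \<alpha>)"
  by (simp add: positive_eigenfunction_def eigenfunction_iff level_power_sum level_power_pos)

subsection \<open>Minimality for large exponents\<close>

text \<open>
  The relation says that \<open>\<phi>\<close> is harmonic for the walk that steps to the parent with
  probability \<open>a / (a + b)\<close> and to each child with probability \<open>b / (q (a + b))\<close>.
\<close>

lemma bounded_harmonic_le_parent:
  assumes harm: "\<And>v. a * \<phi> (p v) + b / real q * (\<Sum>w\<in>children v. \<phi> w) = (a + b) * \<phi> v"
    and "0 < b" "b \<le> a" and bdd: "\<And>v. \<phi> v \<le> B"
  shows "\<phi> v \<le> \<phi> (p v)"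
proof (rule ccontr)
  define d where "d = \<phi> v - \<phi> (p v)"
  assume "\<not> \<phi> v \<le> \<phi> (p v)"
  then have d: "d > 0" by (simp add: d_def)
  \<comment> \<open>By \<open>harm\<close>, \<open>b\<close> times the mean increment to the
    children equals \<open>a\<close> times the increment from \<open>p u\<close> to
    \<open>u\<close>. The latter is at least \<open>a * d\<close>, hence at least
    \<open>b * d\<close>.\<close>
  have step: "\<exists>w\<in>children u. d \<le> \<phi> w - \<phi> (p w)" if u: "d \<le> \<phi> u - \<phi> (p u)" for u
  proof (rule ccontr)
    assume "\<not> ?thesis"
    then have "\<phi> w < \<phi> u + d" if "w \<in> children u" for w
      using that mem_children_iff[of w u] by force
    moreover have "children u \<noteq> {}"
      using card_children[of u] q_ge_2 by auto
    ultimately have "(\<Sum>w\<in>children u. \<phi> w) < (\<Sum>w\<in>children u. \<phi> u + d)"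
      using finite_children by (intro sum_strict_mono)
    then have "(\<Sum>w\<in>children u. \<phi> w) < real q * (\<phi> u + d)"
      by (simp add: card_children)
    then have "b / real q * (\<Sum>w\<in>children u. \<phi> w) < b / real q * (real q * (\<phi> u + d))"
      using assms(2) q_ge_2 by (intro mult_strict_left_mono) auto
    then have "(a + b) * \<phi> u < a * \<phi> (p u) + b * (\<phi> u + d)"
      using harm[of u] q_ge_2 by simp
    moreover have "b * d \<le> a * d" "a * d \<le> a * (\<phi> u - \<phi> (p u))"
      using d u assms(2,3) by (auto intro!: mult_right_mono mult_left_mono)
    ultimately show False
      by (simp add: algebra_simps)
  qed
  have "\<exists>u. d \<le> \<phi> u - \<phi> (p u) \<and> \<phi> v + real n * d \<le> \<phi> u" for n
  proof (induction n)
    case 0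
    show ?case by (intro exI[of _ v]) (simp add: d_def)
  next
    case (Suc n)
    then obtain u where u: "d \<le> \<phi> u - \<phi> (p u)" "\<phi> v + real n * d \<le> \<phi> u" by blast
    obtain w where "w \<in> children u" "d \<le> \<phi> w - \<phi> (p w)"
      using step[OF u(1)] by blast
    with u(2) show ?case
      by (intro exI[of _ w]) (auto simp: mem_children_iff algebra_simps)
  qed
  moreover obtain n where "B - \<phi> v < real n * d"
    using reals_Archimedean3[OF d] by blast
  ultimately show False
    using bdd by (smt (verit))
qed

text \<open>The one-sided bound applies to both \<open>\<phi>\<close> and \<open>- \<phi>\<close>,
  giving equality along edges; connectedness does the rest.\<close>

lemma bounded_harmonic_const:
  assumes harm: "\<And>v. a * \<phi> (p v) + b / real q * (\<Sum>w\<in>children v. \<phi> w) = (a + b) * \<phi> v"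
    and "0 < b" "b \<le> a" and bdd: "\<And>v. \<bar>\<phi> v\<bar> \<le> B"
  shows "\<phi> v = \<phi> w"
proof -
  have le: "\<phi> v \<le> \<phi> (p v)" for v
    using bdd by (intro bounded_harmonic_le_parent[OF harm assms(2,3), of B]) (auto simp: abs_le_iff)
  have ge: "- \<phi> v \<le> - \<phi> (p v)" for v
  proof (rule bounded_harmonic_le_parent[where \<phi> = "\<lambda>v. - \<phi> v", OF _ assms(2,3)])
    show "a * - \<phi> (p v) + b / real q * (\<Sum>w\<in>children v. - \<phi> w) = (a + b) * - \<phi> v" for v
      using harm[of v] by (simp add: sum_negf)
    show "- \<phi> v \<le> B" for v
      using bdd[of v] by (simp add: abs_le_iff)
  qed
  have parent: "\<phi> (p v) = \<phi> v" for v
    using le[of v] ge[of v] by simp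
  have adj: "\<phi> w = \<phi> v" if "E v w" for v w
  proof -
    have "w = p v \<or> p w = v"
      using that neighbours_eq[of v] mem_children_iff by blast
    then show ?thesis
      using parent by metis
  qed
  have "E\<^sup>*\<^sup>* v w"
    using is_tree by (auto simp: is_tree_def)
  then show ?thesis
    by induction (auto simp: adj)
qed

lemma minimal_level_power:
  assumes "\<alpha> \<ge> 1/2"
  shows "minimal_eigenfunction q E ((real q powr \<alpha> + real q powr (1 - \<alpha>)) / (real q + 1)) (level_power \<alpha>)"
  unfolding minimal_eigenfunction_def
proof (intro conjI allI impI positive_eigenfunction_level_power)
  let ?f = "level_power \<alpha>"
  fix g
  assume g: "eigenfunction q E ((real q powr \<alpha> + real q powr (1 - \<alpha>)) / (real q + 1)) g \<and>
    (\<forall>v. 0 \<le> g v) \<and> (\<forall>v. g v \<le> ?f v)"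
  then have eig: "g (p v) + (\<Sum>w\<in>children v. g w) = (real q powr \<alpha> + real q powr (1 - \<alpha>)) * g v" for v
    by (simp add: eigenfunction_iff)
  define \<phi> where "\<phi> v = g v / ?f v" for v
  have g_eq: "g v = \<phi> v * ?f v" for v
    using level_power_pos[of \<alpha> v] by (simp add: \<phi>_def)
  have harm: "real q powr \<alpha> * \<phi> (p v) + real q powr (1 - \<alpha>) / real q * (\<Sum>w\<in>children v. \<phi> w)
      = (real q powr \<alpha> + real q powr (1 - \<alpha>)) * \<phi> v" for v
  proof -
    have "(\<Sum>w\<in>children v. g w) = (\<Sum>w\<in>children v. real q powr (1 - \<alpha>) / real q * \<phi> w * ?f v)"
    proof (rule sum.cong[OF refl])
      fix w assume "w \<in> children v"
      then have "?f w = real q powr (1 - \<alpha>) * ?f v / real q"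
        using level_power_children'[of w v \<alpha>] q_ge_2 by (simp add: field_simps)
      then show "g w = real q powr (1 - \<alpha>) / real q * \<phi> w * ?f v"
        by (simp add: g_eq)
    qed
    also have "\<dots> = real q powr (1 - \<alpha>) / real q * (\<Sum>w\<in>children v. \<phi> w) * ?f v"
      by (simp only: sum_distrib_left sum_distrib_right)
    finally have "(real q powr \<alpha> * \<phi> (p v) + real q powr (1 - \<alpha>) / real q * (\<Sum>w\<in>children v. \<phi> w)) * ?f v
      = ((real q powr \<alpha> + real q powr (1 - \<alpha>)) * \<phi> v) * ?f v"
      using eig[of v] by (simp add: g_eq level_power_parent algebra_simps)
    then show ?thesis
      using level_power_pos[of \<alpha> v] by simp
  qed
  have "\<phi> v = \<phi> w" for v w
  proof (rule bounded_harmonic_const[OF harm])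
    \<comment> \<open>The threshold 1/2 enters here, as
      \<open>1 - \<alpha> \<le> \<alpha>\<close>.\<close>
    show "0 < real q powr (1 - \<alpha>)" "real q powr (1 - \<alpha>) \<le> real q powr \<alpha>"
      using q_ge_2 assms by (auto intro: powr_mono)
    show "\<bar>\<phi> v\<bar> \<le> 1" for v
      using g level_power_pos[of \<alpha> v] by (simp add: \<phi>_def)
  qed
  then show "\<exists>c. \<forall>v. g v = c * ?f v"
    using g_eq by metis
qed

subsection \<open>Failure of minimality for small exponents\<close>

definition descendants :: "'v \<Rightarrow> 'v set" where
  "descendants v = {w. \<exists>n. (p ^^ n) w = v}"

lemma h_iterate_parent: "h ((p ^^ n) v) = h v - real n"
  by (induction n) (auto simp: h_parent)

lemma self_mem_descendants: "v \<in> descendants v"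
  unfolding descendants_def by (auto intro: exI[of _ 0])

lemma h_descendants: "w \<in> descendants v \<Longrightarrow> h v \<le> h w"
  using h_iterate_parent by (auto simp: descendants_def)

lemma mem_descendants_iff: "w \<in> descendants v \<longleftrightarrow> w = v \<or> p w \<in> descendants v"
proof
  assume "w \<in> descendants v"
  then obtain n where "(p ^^ n) w = v" by (auto simp: descendants_def)
  then show "w = v \<or> p w \<in> descendants v"
    by (cases n) (auto simp: descendants_def funpow_swap1)
next
  assume "w = v \<or> p w \<in> descendants v"
  then show "w \<in> descendants v"
  proof
    assume "p w \<in> descendants v"
    then obtain n where "(p ^^ n) (p w) = v" by (auto simp: descendants_def)
    then have "(p ^^ Suc n) w = v" by (simp add: funpow_swap1)
    then show ?thesis unfolding descendants_def by blast
  qed (simp add: self_mem_descendants)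
qed

text \<open>Each parent step lowers \<open>h\<close> by 1, so ancestors of one vertex at equal
  height are reached after equally many steps.\<close>

lemma descendants_siblings_disjoint:
  assumes "h v = h v'" "v \<noteq> v'"
  shows "descendants v \<inter> descendants v' = {}"
proof -
  have False if "(p ^^ m) w = v" "(p ^^ n) w = v'" for m n w
    using h_iterate_parent[of m w] h_iterate_parent[of n w] that assms by auto
  then show ?thesis by (auto simp: descendants_def)
qed

text \<open>
  The function is extended by zero outside the descendants of \<open>v\<close>, so the defect of the
  eigenvalue equation is concentrated at the parent of \<open>v\<close>.
\<close>

lemma eigen_sum_restrict_descendants:
  fixes k :: "'v \<Rightarrow> real"
  assumes eig: "\<And>u. k (p u) + (\<Sum>w\<in>children u. k w) = l * k u"
    and zero: "k (p v) = 0"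
  defines "K \<equiv> (\<lambda>u. if u \<in> descendants v then k u else 0)"
  shows "K (p u) + (\<Sum>w\<in>children u. K w) = l * K u + (if u = p v then k v else 0)"
proof (cases "u \<in> descendants v")
  case True
  \<comment> \<open>The parent leaves the descendants only when \<open>u = v\<close>, and there
    \<open>k\<close> vanishes by \<open>zero\<close>.\<close>
  have "K (p u) = k (p u)"
    using True zero mem_descendants_iff[of u v] by (auto simp: K_def)
  moreover have "K w = k w" if "w \<in> children u" for w
    using that True mem_descendants_iff[of w v] by (auto simp: K_def mem_children_iff)
  moreover have "u \<noteq> p v"
    using True h_descendants[of u v] h_parent[of v] by auto
  ultimately show ?thesis
    using eig[of u] True by (simp add: K_def)
next
  case False
  then have "K (p u) = 0" "K u = 0"
    using mem_descendants_iff[of u v] by (auto simp: K_def)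
  \<comment> \<open>The only vertex through which one can enter the descendants from outside is
    \<open>v\<close>.\<close>
  moreover have "K w = (if w = v then k v else 0)" if "w \<in> children u" for w
    using that False mem_descendants_iff[of w v] by (auto simp: K_def mem_children_iff)
  then have "(\<Sum>w\<in>children u. K w) = (\<Sum>w\<in>children u. if w = v then k v else 0)"
    by (intro sum.cong) auto
  then have "(\<Sum>w\<in>children u. K w) = (if u = p v then k v else 0)"
    using finite_children by (auto simp: mem_children_iff)
  ultimately show ?thesis by simp
qed

lemma not_minimal_level_power:
  assumes "\<alpha> < 1/2"
  shows "\<not> minimal_eigenfunction q E ((real q powr \<alpha> + real q powr (1 - \<alpha>)) / (real q + 1)) (level_power \<alpha>)"
proof
  let ?f = "level_power \<alpha>"
  let ?l = "real q powr \<alpha> + real q powr (1 - \<alpha>)"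
  assume min: "minimal_eigenfunction q E (?l / (real q + 1)) ?f"
  fix u :: 'v
  obtain v v' where v: "v \<in> children u" "v' \<in> children u" "v \<noteq> v'"
  proof -
    have "Suc (Suc 0) \<le> card (children u)"
      using q_ge_2 card_children by simp
    then show ?thesis
      using that by (auto simp: card_le_Suc_iff)
  qed
  then have par: "p v = u" "p v' = u" and hv: "h v = h u + 1" "h v' = h u + 1"
    using mem_children_iff h_mem_children by blast+
  \<comment> \<open>This factor makes \<open>k\<close> vanish at \<open>u\<close>.\<close>
  define c where "c = ?f u / level_power (1 - \<alpha>) u"
  define k where "k w = ?f w - c * level_power (1 - \<alpha>) w" for w
  have c: "c = real q powr ((1 - 2 * \<alpha>) * h u)"
    by (simp add: c_def level_power_def algebra_simps flip: powr_diff)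
  \<comment> \<open>Since \<open>1 - 2 * \<alpha>\<close> is positive, this form shows the sign of
    \<open>k\<close> from the height relative to \<open>u\<close>.\<close>
  have k: "k w = ?f w * (1 - real q powr ((1 - 2 * \<alpha>) * (h u - h w)))" for w
    by (simp add: k_def c level_power_def algebra_simps flip: powr_add)
  have k_u: "k u = 0"
    using q_ge_2 by (simp add: k)
  have k_nonneg: "0 \<le> k w" if "h u \<le> h w" for w
  proof -
    have "(1 - 2 * \<alpha>) * (h u - h w) \<le> 0"
      using assms that by (simp add: mult_nonneg_nonpos)
    then have "real q powr ((1 - 2 * \<alpha>) * (h u - h w)) \<le> real q powr 0"
      using q_ge_2 by (intro powr_mono) auto
    then show ?thesis
      using q_ge_2 level_power_pos[of \<alpha> w] by (simp add: k)
  qed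
  have k_le: "k w \<le> ?f w" for w
    using level_power_pos[of \<alpha> w] level_power_pos[of "1 - \<alpha>" w] by (simp add: k_def c)
  have k_v: "k v > 0" "k v = k v'"
  proof -
    have "real q powr ((1 - 2 * \<alpha>) * (h u - h v)) < real q powr 0"
      using assms q_ge_2 by (intro powr_less_mono) (auto simp: hv)
    then show "k v > 0"
      using q_ge_2 level_power_pos[of \<alpha> v] by (simp add: k)
    show "k v = k v'"
      by (simp add: k level_power_def hv)
  qed
  have k_eig: "k (p w) + (\<Sum>x\<in>children w. k x) = ?l * k w" for w
    using level_power_sum[of \<alpha> w] level_power_sum[of "1 - \<alpha>" w]
    by (simp add: k_def sum_subtractf right_diff_distrib flip: sum_distrib_left)
      (simp add: algebra_simps flip: distrib_left)
  define K where "K = (\<lambda>w. if w \<in> descendants v then k w else 0)"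
  define K' where "K' = (\<lambda>w. if w \<in> descendants v' then k w else 0)"
  \<comment> \<open>The defects of \<open>K\<close> and \<open>K'\<close> at \<open>u\<close> cancel
    because \<open>k v = k v'\<close>.\<close>
  define g where "g w = (?f w + K w - K' w) / 2" for w
  have K: "K (p w) + (\<Sum>x\<in>children w. K x) = ?l * K w + (if w = u then k v else 0)" for w
    using eigen_sum_restrict_descendants[OF k_eig, of v w] par k_u by (simp add: K_def)
  have K': "K' (p w) + (\<Sum>x\<in>children w. K' x) = ?l * K' w + (if w = u then k v else 0)" for w
    using eigen_sum_restrict_descendants[OF k_eig, of v' w] par k_u k_v by (simp add: K'_def)
  have "g (p w) + (\<Sum>x\<in>children w. g x) = ?l * g w" for w
  proof -
    have "g (p w) + (\<Sum>x\<in>children w. g x) =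
      ((?f (p w) + (\<Sum>x\<in>children w. ?f x)) + (K (p w) + (\<Sum>x\<in>children w. K x))
        - (K' (p w) + (\<Sum>x\<in>children w. K' x))) / 2"
      by (simp add: g_def sum_subtractf sum.distrib flip: sum_divide_distrib) (simp add: field_simps)
    then show ?thesis
      unfolding K K' level_power_sum by (simp add: g_def algebra_simps)
  qed
  then have g_eig: "eigenfunction q E (?l / (real q + 1)) g"
    by (simp add: eigenfunction_iff)
  have disj: "descendants v \<inter> descendants v' = {}"
    using descendants_siblings_disjoint v(3) hv by simp
  have bounds: "0 \<le> K w" "K w \<le> ?f w" "0 \<le> K' w" "K' w \<le> ?f w" for w
    using k_nonneg[of w] k_le[of w] level_power_pos[of \<alpha> w] h_descendants[of w v]
      h_descendants[of w v'] hv by (auto simp: K_def K'_def)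
  have "0 \<le> g w \<and> g w \<le> ?f w" for w
    using bounds[of w] by (simp add: g_def)
  then obtain d where d: "\<And>w. g w = d * ?f w"
    using min g_eig unfolding minimal_eigenfunction_def by blast
  \<comment> \<open>At \<open>u\<close> both corrections vanish, forcing the ratio 1/2; at
    \<open>v\<close> the positive term \<open>k v\<close> makes the ratio larger.\<close>
  have "u \<notin> descendants v" "u \<notin> descendants v'"
    using h_descendants[of u] hv by fastforce+
  then have "d = 1/2"
    using d[of u] level_power_pos[of \<alpha> u] by (simp add: g_def K_def K'_def)
  then have "g v = 1/2 * ?f v"
    using d[of v] by (simp only:)
  moreover have "g v = (?f v + k v) / 2"
    using disj self_mem_descendants[of v] by (auto simp: g_def K_def K'_def)
  ultimately show False
    using k_v(1) by simp
qed

end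

theorem mainTheorem2:
  fixes q :: nat
    and E :: "'v \<Rightarrow> 'v \<Rightarrow> bool"
    and \<omega> :: "(nat \<Rightarrow> 'v) set"
    and h :: "'v \<Rightarrow> real"
    and \<alpha> :: real
  assumes "q \<ge> 2"
    and "homogeneous_tree q E"
    and "\<omega> \<in> tree_ends E"
    and "horofunction E h"
    and "tends_to_end h \<omega>"
  defines "s \<equiv> (real q powr \<alpha> + real q powr (1 - \<alpha>)) / (real q + 1)"
    and "f \<equiv> (\<lambda>v. real q powr (- \<alpha> * h v))"
  shows "positive_eigenfunction q E s f \<and>
         (minimal_eigenfunction q E s f \<longleftrightarrow> \<alpha> \<in> {1/2..})"
proof -
  obtain p where p: "\<And>v. E v (p v) \<and> h (p v) = h v - 1 \<and> (\<forall>w. E v w \<and> w \<noteq> p v \<longrightarrow> h w = h v + 1)"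
    using horofunction_parent[OF assms(2,4)] by metis
  interpret horofunction_tree q E h p
    using assms(1,2) p by unfold_locales auto
  have "f = level_power \<alpha>"
    by (simp add: f_def level_power_def fun_eq_iff)
  then show ?thesis
    using positive_eigenfunction_level_power minimal_level_power not_minimal_level_power
    by (metis atLeast_iff not_le s_def)
qed

end
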